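(* Let $F\colon\mathcal P^{\triangle}\to\mathcal P^{\circ\bullet}$ be the map from partitions with extra singletons to two-colored partitions defined in the context, restricted to the set $\mathcal P^{\triangle}_{\mathrm{even}}$ of partitions with extra singletons of even length (so preimages $F^{-1}$ are taken inside $\mathcal P^{\triangle}_{\mathrm{even}}$). Then $F$ defines a one-to-one correspondence between categories of partitions with extra singletons all of whose elements have even length and categories of two-colored partitions that are invariant under color inversion. More precisely: (1) If $\mathcal C\subseteq\mathcal P^\triangle_{\mathrm{even}}$ is a category of partitions with extra singletons, then $F(\mathcal C)$ is a category of two-colored partitions which is invariant under color inversion. (2) If $\tilde{\mathcal C}\subseteq\mathcal P^{\circ\bullet}$ is a category of two-colored partitions invariant under color inversion, then $F^{-1}(\tilde{\mathcal C})$ is a category of partitions with extra singletons (of even length). Moreover $F^{-1}(F(\mathcal C))=\mathcal C$ and $F(F^{-1}(\tilde{\mathcal C}))=\tilde{\mathcal C}$ for all such $\mathcal C$, $\tilde{\mathcal C}$.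
   Context: Partitions: for $k,l\in\mathbb N_0$, $\mathcal P(k,l)$ is the set of set partitions of a set consisting of $k$ upper and $l$ lower points (each row ordered left to right); the length is $k+l$. Operations: tensor product (horizontal juxtaposition); composition $qp\in\mathcal P(k,m)$ of $p\in\mathcal P(k,l)$, $q\in\mathcal P(l,m)$ (identify the lower row of $p$ with the upper row of $q$, join blocks, restrict to the upper points of $p$ and lower points of $q$, discarding components touching neither); involution $p^*$ (exchange the two rows). Colored partitions: every point carries a color from an alphabet; the words $w_1,w_2$ of colors of the upper and lower row are the upper and lower color patterns. The operations on colored partitions are the tensor product (horizontal juxtaposition), the composition $qp$ (identify the lower row of $p$ with the upper row of $q$, join blocks, restrict to the upper points of $p$ and lower points of $q$, discarding components touching neither) and the involution $p^*$ (exchange the two rows), every point keeping its color, but $qp$ is defined only if the lower color pattern of $p$ equals the upper color pattern of $q$. Partitions with extra singletons ($\mathcal P^\triangle$): colors $\ell$ and $\triangle$, such that every point of color $\triangle$ is a block of size one (an extra singleton). The length counts all points, including those of color $\triangle$. A category of partitions with extra singletons is a subset of $\mathcal P^\triangle$ closed under tensor product, composition and involution and containing: the identity $\mathrm{id}$ (one upper and one lower $\ell$-point in one block), $\mathrm{id}_\triangle$ (one upper and one lower $\triangle$-point), the pair (two lower $\ell$-points in one block), and two lower $\triangle$-points. Two-colored partitions ($\mathcal P^{\circ\bullet}$): colors $\circ,\bullet$, no restriction on blocks. A category of two-colored partitions is a subset of $\mathcal P^{\circ\bullet}$ closed under tensor product, composition and involution and containing the identities $\circ\to\circ$, $\bullet\to\bullet$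 (one block of one upper and one lower point of the same color) and the pair blocks with no upper points and lower color patterns $\circ\bullet$ and $\bullet\circ$. Color inversion exchanges $\circ\leftrightarrow\bullet$ at all points of a partition. The map $F$: for a word $w$ over $\{\ell,\triangle\}$, color its positions alternately $\circ,\bullet,\circ,\bullet,\dots$ starting with $\circ$, and then delete the positions carrying $\triangle$; the resulting word over $\{\circ,\bullet\}$ is $F(w)$. For $p\in\mathcal P^\triangle$ with color patterns $w_1,w_2$, $F(p)$ is the two-colored partition with color patterns $F(w_1),F(w_2)$ and with the block structure of $p$ after deleting all extra singletons. *)

theory Defs
  imports Main "HOL-Library.Disjoint_Sets"
begin

text \<open>Points are numbered from 0, from left to right, in each row.\<close>

datatype point = Up nat | Lo nat

definition points :: "nat \<Rightarrow> nat \<Rightarrow> point set" where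
  "points k l = Up ` {..<k} \<union> Lo ` {..<l}"

definition partitions :: "nat \<Rightarrow> nat \<Rightarrow> point set set set" where
  "partitions k l = {P. partition_on (points k l) P}"

text \<open>The datatype carries only the raw data; \<open>colored_partitions\<close> below singles out
  the values whose third component really is a set partition of the points.\<close>

datatype 'c cpartition =
  CPartition (upper: "'c list") (lower: "'c list") (blocks: "point set set")

definition colored_partitions :: "'c cpartition set" where
  "colored_partitions = {p. blocks p \<in> partitions (length (upper p)) (length (lower p))}"

definition cpoints :: "'c cpartition \<Rightarrow> point set" where
  "cpoints p = points (length (upper p)) (length (lower p))"

fun color :: "'c cpartition \<Rightarrow> point \<Rightarrow> 'c" where
  "color p (Up i) = upper p ! i"
| "color p (Lo j) = lower p ! j"

definition total_length :: "'c cpartition \<Rightarrow> nat" where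
  "total_length p = length (upper p) + length (lower p)"


subsection \<open>Operations\<close>

fun shift :: "nat \<Rightarrow> nat \<Rightarrow> point \<Rightarrow> point" where
  "shift k l (Up i) = Up (k + i)"
| "shift k l (Lo j) = Lo (l + j)"

definition tensor :: "'c cpartition \<Rightarrow> 'c cpartition \<Rightarrow> 'c cpartition" where
  "tensor p q = CPartition (upper p @ upper q) (lower p @ lower q)
     (blocks p \<union> (\<lambda>B. shift (length (upper p)) (length (lower p)) ` B) ` blocks q)"

fun swap_rows :: "point \<Rightarrow> point" where
  "swap_rows (Up i) = Lo i"
| "swap_rows (Lo j) = Up j"

definition involution :: "'c cpartition \<Rightarrow> 'c cpartition" where
  "involution p = CPartition (lower p) (upper p) ((\<lambda>B. swap_rows ` B) ` blocks p)"

text \<open>For the composition \<open>qp\<close>, \<open>p\<close> is drawn between the rows \<open>Top\<close> and \<open>Mid\<close>,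
  and \<open>q\<close> between the rows \<open>Mid\<close> and \<open>Bot\<close>.\<close>

datatype point3 = Top nat | Mid nat | Bot nat

fun top_mid :: "point \<Rightarrow> point3" where
  "top_mid (Up i) = Top i"
| "top_mid (Lo j) = Mid j"

fun mid_bot :: "point \<Rightarrow> point3" where
  "mid_bot (Up i) = Mid i"
| "mid_bot (Lo j) = Bot j"

fun top_bot :: "point \<Rightarrow> point3" where
  "top_bot (Up i) = Top i"
| "top_bot (Lo j) = Bot j"

definition linked :: "'c cpartition \<Rightarrow> 'c cpartition \<Rightarrow> (point3 \<times> point3) set" where
  "linked q p = (\<Union>B\<in>blocks p. top_mid ` B \<times> top_mid ` B) \<union> (\<Union>B\<in>blocks q. mid_bot ` B \<times> mid_bot ` B)"

text \<open>\<open>linked q p\<close> is symmetric, so its reflexive transitive closure is the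
  equivalence relation of lying in the same joined block. Taking the quotient of the outer
  points only discards the components touching neither outer row. The value is meaningful
  only if \<open>lower p = upper q\<close>; every use below is guarded by this condition.\<close>

definition compose :: "'c cpartition \<Rightarrow> 'c cpartition \<Rightarrow> 'c cpartition" where
  "compose q p = CPartition (upper p) (lower q)
     (points (length (upper p)) (length (lower q)) //
        {(x, y). x \<in> points (length (upper p)) (length (lower q)) \<and>
                 y \<in> points (length (upper p)) (length (lower q)) \<and>
                 (top_bot x, top_bot y) \<in> (linked q p)\<^sup>*})"

definition closed_under_operations :: "'c cpartition set \<Rightarrow> bool" where
  "closed_under_operations C \<longleftrightarrow>
     (\<forall>p\<in>C. \<forall>q\<in>C. tensor p q \<in> C) \<and>
     (\<forall>p\<in>C. \<forall>q\<in>C. lower p = upper q \<longrightarrow> compose q p \<in> C) \<and>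
     (\<forall>p\<in>C. involution p \<in> C)"


subsection \<open>Partitions with extra singletons\<close>

datatype ecolor = Ell | Triangle

definition es_partitions :: "ecolor cpartition set" where
  "es_partitions = {p \<in> colored_partitions.
     \<forall>x\<in>cpoints p. color p x = Triangle \<longrightarrow> {x} \<in> blocks p}"

definition es_partitions_even :: "ecolor cpartition set" where
  "es_partitions_even = {p \<in> es_partitions. even (total_length p)}"

definition es_category :: "ecolor cpartition set \<Rightarrow> bool" where
  "es_category C \<longleftrightarrow> C \<subseteq> es_partitions \<and> closed_under_operations C \<and>
     CPartition [Ell] [Ell] {{Up 0, Lo 0}} \<in> C \<and>
     CPartition [Triangle] [Triangle] {{Up 0}, {Lo 0}} \<in> C \<and>
     CPartition [] [Ell, Ell] {{Lo 0, Lo 1}} \<in> C \<and>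
     CPartition [] [Triangle, Triangle] {{Lo 0}, {Lo 1}} \<in> C"


subsection \<open>Two-colored partitions\<close>

datatype tcolor = White | Black

definition tc_partitions :: "tcolor cpartition set" where
  "tc_partitions = colored_partitions"

definition tc_category :: "tcolor cpartition set \<Rightarrow> bool" where
  "tc_category C \<longleftrightarrow> C \<subseteq> tc_partitions \<and> closed_under_operations C \<and>
     CPartition [White] [White] {{Up 0, Lo 0}} \<in> C \<and>
     CPartition [Black] [Black] {{Up 0, Lo 0}} \<in> C \<and>
     CPartition [] [White, Black] {{Lo 0, Lo 1}} \<in> C \<and>
     CPartition [] [Black, White] {{Lo 0, Lo 1}} \<in> C"

fun swap_color :: "tcolor \<Rightarrow> tcolor" where
  "swap_color White = Black"
| "swap_color Black = White"

definition color_inversion :: "tcolor cpartition \<Rightarrow> tcolor cpartition" where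
  "color_inversion p = CPartition (map swap_color (upper p)) (map swap_color (lower p)) (blocks p)"

definition color_inversion_invariant :: "tcolor cpartition set \<Rightarrow> bool" where
  "color_inversion_invariant C \<longleftrightarrow> color_inversion ` C = C"


subsection \<open>From extra singletons to two colors\<close>

definition F_word :: "ecolor list \<Rightarrow> tcolor list" where
  "F_word w = map (\<lambda>i. if even i then White else Black) (filter (\<lambda>i. w ! i = Ell) [0..<length w])"

text \<open>The new position of the \<open>Ell\<close>-point at position \<open>i\<close> of \<open>w\<close>, after
  deleting all \<open>Triangle\<close>-points of the row.\<close>

definition new_position :: "ecolor list \<Rightarrow> nat \<Rightarrow> nat" where
  "new_position w i = length (filter (\<lambda>c. c = Ell) (take i w))"

fun new_point :: "ecolor cpartition \<Rightarrow> point \<Rightarrow> point" where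
  "new_point p (Up i) = Up (new_position (upper p) i)"
| "new_point p (Lo j) = Lo (new_position (lower p) j)"

text \<open>On \<open>es_partitions\<close>, the blocks all of whose points have color \<open>Ell\<close> are exactly
  those that are not extra singletons.\<close>

definition F_map :: "ecolor cpartition \<Rightarrow> tcolor cpartition" where
  "F_map p = CPartition (F_word (upper p)) (F_word (lower p))
     ((\<lambda>B. new_point p ` B) ` {B \<in> blocks p. \<forall>x\<in>B. color p x = Ell})"

definition F_preimage :: "tcolor cpartition set \<Rightarrow> ecolor cpartition set" where
  "F_preimage D = F_map -` D \<inter> es_partitions_even"

end

theory Submission
  imports Defs
begin

text \<open>
  A partition with extra singletons is determined by its two color patterns and its image under
  \<open>F_map\<close>, and \<open>F_map\<close> respects composition, involution and, on even length, the tensor product,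
  except that a first factor with an odd upper row inverts the colors of the second one. This
  gives (2). For (1), tensoring with a pair of triangles from the left inverts colors. Two
  patterns with the same image and the same parity of length differ by insertions and deletions of
  adjacent triangles, so every category contains a partition between them that maps to an identity.
  Composing with such connecting partitions makes the inner patterns of two factors agree, and also
  brings any preimage of an element of \<open>F_map ` C\<close> back into \<open>C\<close>.
\<close>

subsection \<open>Set partitions and the operations\<close>

text \<open>Classes of points of \<open>A\<close> stay inside \<open>A\<close> and \<open>s\<close>
  lives on \<open>B\<close>, so \<open>f\<close> carries the class of \<open>x\<close> onto the
  class of \<open>f x\<close>. Later \<open>A\<close> is the set of \<open>Ell\<close>-points, while
  \<open>r\<close> relates all outer points.\<close>

lemma image_quotient_eq:
  assumes "f ` A = B" and "\<And>x. x \<in> A \<Longrightarrow> r `` {x} \<subseteq> A" and "s \<subseteq> B \<times> B"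
    and "\<And>x y. x \<in> A \<Longrightarrow> y \<in> A \<Longrightarrow> (x, y) \<in> r \<longleftrightarrow> (f x, f y) \<in> s"
  shows "(\<lambda>X. f ` X) ` (A // r) = B // s"
proof -
  have "f ` (r `` {x}) = s `` {f x}" if x: "x \<in> A" for x
  proof
    show "f ` (r `` {x}) \<subseteq> s `` {f x}"
      using assms(2)[OF x] assms(4)[OF x] by blast
    show "s `` {f x} \<subseteq> f ` (r `` {x})"
      using assms(1,3) assms(4)[OF x] by blast
  qed
  then show ?thesis
    unfolding quotient_def using assms(1) by auto
qed

text \<open>The relation inside \<open>compose\<close>, named so that the blocks of a composition
  appear as a quotient by it.\<close>

definition comp_rel :: "'c cpartition \<Rightarrow> 'c cpartition \<Rightarrow> (point \<times> point) set" where
  "comp_rel q p = {(x, y). x \<in> points (length (upper p)) (length (lower q)) \<and>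
                 y \<in> points (length (upper p)) (length (lower q)) \<and>
                 (top_bot x, top_bot y) \<in> (linked q p)\<^sup>*}"

lemma compose_sel [simp]:
  "upper (compose q p) = upper p" "lower (compose q p) = lower q"
  "blocks (compose q p) = points (length (upper p)) (length (lower q)) // comp_rel q p"
  by (simp_all add: compose_def comp_rel_def)

lemma tensor_sel [simp]:
  "upper (tensor p q) = upper p @ upper q" "lower (tensor p q) = lower p @ lower q"
  "blocks (tensor p q) =
    blocks p \<union> (\<lambda>B. shift (length (upper p)) (length (lower p)) ` B) ` blocks q"
  by (simp_all add: tensor_def)

lemma involution_sel [simp]:
  "upper (involution p) = lower p" "lower (involution p) = upper p"
  "blocks (involution p) = (\<lambda>B. swap_rows ` B) ` blocks p"
  by (simp_all add: involution_def)

lemma color_inversion_sel [simp]: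
  "upper (color_inversion p) = map swap_color (upper p)"
  "lower (color_inversion p) = map swap_color (lower p)"
  "blocks (color_inversion p) = blocks p"
  by (simp_all add: color_inversion_def)

lemma F_map_sel [simp]:
  "upper (F_map p) = F_word (upper p)" "lower (F_map p) = F_word (lower p)"
  by (simp_all add: F_map_def)

lemma mem_points [simp]:
  "Up i \<in> points k l \<longleftrightarrow> i < k" "Lo i \<in> points k l \<longleftrightarrow> i < l"
  by (auto simp: points_def)

lemma inj_top_bot: "top_bot x = top_bot y \<Longrightarrow> x = y"
  by (cases x; cases y) auto

lemma sym_linked: "sym (linked q p)"
  by (auto simp: sym_def linked_def)

lemma linked_lower: "B \<in> blocks p \<Longrightarrow> x \<in> B \<Longrightarrow> y \<in> B \<Longrightarrow> (top_mid x, top_mid y) \<in> linked q p"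
  by (auto simp: linked_def)

lemma linked_upper: "B \<in> blocks q \<Longrightarrow> x \<in> B \<Longrightarrow> y \<in> B \<Longrightarrow> (mid_bot x, mid_bot y) \<in> linked q p"
  by (auto simp: linked_def)

lemma linkedE:
  assumes "(a, b) \<in> linked q p"
  obtains B x y where "B \<in> blocks p" "x \<in> B" "y \<in> B" "a = top_mid x" "b = top_mid y"
  | B x y where "B \<in> blocks q" "x \<in> B" "y \<in> B" "a = mid_bot x" "b = mid_bot y"
  using assms by (auto simp: linked_def)

lemma equiv_comp_rel: "equiv (points (length (upper p)) (length (lower q))) (comp_rel q p)"
  using sym_rtrancl[OF sym_linked[of q p]]
  by (intro equivI) (auto simp: comp_rel_def refl_on_def sym_def trans_def)

lemma compose_colored: "compose q p \<in> colored_partitions"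
  using partition_on_quotient[OF equiv_comp_rel] by (simp add: colored_partitions_def partitions_def)

lemma colored_partition_on: "p \<in> colored_partitions \<Longrightarrow> partition_on (cpoints p) (blocks p)"
  by (simp add: colored_partitions_def partitions_def cpoints_def)

lemma colored_iff: "p \<in> colored_partitions \<longleftrightarrow> partition_on (cpoints p) (blocks p)"
  by (simp add: colored_partitions_def partitions_def cpoints_def)

lemma swap_rows_swap_rows [simp]: "swap_rows (swap_rows x) = x"
  by (cases x) auto

lemma inj_swap_rows: "inj swap_rows"
  by (metis injI swap_rows_swap_rows)

lemma swap_rows_points: "swap_rows ` points k l = points l k"
  by (auto simp: points_def image_Un image_image)

text \<open>Images of nonempty blocks are nonempty, so the removal of the empty set in
  \<open>partition_on_inj_image\<close> changes nothing.\<close>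

lemma partition_on_image:
  assumes "partition_on A P" and "inj_on f A"
  shows "partition_on (f ` A) ((\<lambda>X. f ` X) ` P)"
proof -
  have "(\<lambda>X. f ` X) ` P - {{}} = (\<lambda>X. f ` X) ` P"
    using partition_onD3[OF assms(1)] by auto
  then show ?thesis
    using partition_on_inj_image[OF assms] by simp
qed

lemma involution_colored: "p \<in> colored_partitions \<Longrightarrow> involution p \<in> colored_partitions"
  using partition_on_image[of "cpoints p" "blocks p" swap_rows] inj_on_subset[OF inj_swap_rows]
  by (simp add: colored_iff cpoints_def swap_rows_points)

lemma inj_shift: "inj (shift k l)"
proof (rule injI)
  show "x = y" if "shift k l x = shift k l y" for x y
    using that by (cases x; cases y) auto
qed

lemma points_add: "points (k + k') (l + l') = points k l \<union> shift k l ` points k' l'"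
proof -
  have "x \<in> points (k + k') (l + l') \<longleftrightarrow> x \<in> points k l \<union> shift k l ` points k' l'" for x
  proof (cases x)
    case (Up i)
    have "i < k + k' \<longleftrightarrow> i < k \<or> (\<exists>j<k'. i = k + j)"
      by presburger
    then show ?thesis
      using Up by (auto simp: points_def image_Un image_image image_iff Bex_def)
  next
    case (Lo i)
    have "i < l + l' \<longleftrightarrow> i < l \<or> (\<exists>j<l'. i = l + j)"
      by presburger
    then show ?thesis
      using Lo by (auto simp: points_def image_Un image_image image_iff Bex_def)
  qed
  then show ?thesis by blast
qed

lemma points_shift_disjoint: "points k l \<inter> shift k l ` A = {}"
proof -
  have "shift k l x \<notin> points k l" for x
    by (cases x) auto
  then show ?thesis by blast
qed

lemma partition_on_Un:
  assumes "partition_on A P" "partition_on B Q" "A \<inter> B = {}"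
  shows "partition_on (A \<union> B) (P \<union> Q)"
proof (rule partition_onI)
  show "\<Union>(P \<union> Q) = A \<union> B" and "{} \<notin> P \<union> Q"
    using assms(1,2) by (auto simp: partition_on_def)
  show "disjnt X Y" if "X \<in> P \<union> Q" "Y \<in> P \<union> Q" "X \<noteq> Y" for X Y
    using that assms disjointD[OF partition_onD2[OF assms(1)]] disjointD[OF partition_onD2[OF assms(2)]]
      partition_onD1[OF assms(1)] partition_onD1[OF assms(2)]
    unfolding disjnt_def by blast
qed

lemma tensor_colored:
  assumes "p \<in> colored_partitions" "q \<in> colored_partitions"
  shows "tensor p q \<in> colored_partitions"
  using partition_on_Un[OF colored_partition_on[OF assms(1)]
      partition_on_image[OF colored_partition_on[OF assms(2)] inj_on_subset[OF inj_shift]]]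
    points_shift_disjoint
  by (simp add: colored_iff cpoints_def points_add)

section \<open>Identity partitions as neutral elements\<close>

definition word_id :: "'c list \<Rightarrow> 'c cpartition" where
  "word_id w = CPartition w w ((\<lambda>i. {Up i, Lo i}) ` {..<length w})"

lemma word_id_sel [simp]:
  "upper (word_id w) = w" "lower (word_id w) = w"
  "blocks (word_id w) = (\<lambda>i. {Up i, Lo i}) ` {..<length w}"
  by (simp_all add: word_id_def)

lemma word_id_colored: "word_id w \<in> colored_partitions"
  by (auto simp: colored_iff partition_on_def cpoints_def points_def disjoint_def)

text \<open>A partition is the quotient by its own same-block relation, so it suffices to compare
  that relation with linkage of outer points.\<close>

lemma blocks_compose_eqI:
  assumes "partition_on (points (length (upper p)) (length (lower q))) P"
    and "\<And>x y. x \<in> points (length (upper p)) (length (lower q)) \<Longrightarrow>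
      y \<in> points (length (upper p)) (length (lower q)) \<Longrightarrow>
      (top_bot x, top_bot y) \<in> (linked q p)\<^sup>* \<longleftrightarrow> (\<exists>B\<in>P. x \<in> B \<and> y \<in> B)"
  shows "blocks (compose q p) = P"
proof -
  have "comp_rel q p = {(x, y). \<exists>B\<in>P. x \<in> B \<and> y \<in> B}"
    using assms(2) partition_onD1[OF assms(1)] unfolding comp_rel_def by blast
  then show ?thesis
    using partition_on_eq_quotient[OF assms(1)] by simp
qed

text \<open>The reflexive closure of \<open>R\<close> is used because a same-block relation is
  reflexive only on the points of the partition, and because some links collapse to a single point
  under \<open>f\<close>.\<close>

lemma rtrancl_image_trans:
  assumes "(a, b) \<in> L\<^sup>*" and "trans R" and "\<And>a b. (a, b) \<in> L \<Longrightarrow> (f a, f b) \<in> R\<^sup>="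
  shows "(f a, f b) \<in> R\<^sup>="
  using assms(1)
proof (induction rule: rtrancl_induct)
  case (step b c)
  then show ?case
    using assms(3)[OF step.hyps(2)] transD[OF assms(2)] by auto
qed simp

text \<open>Contracts the strands of an identity glued below a partition: links of the partition
  become same-block pairs, links of the identity become equalities. \<open>collapse_down\<close>
  does the same for an identity glued above.\<close>

fun collapse_up :: "point3 \<Rightarrow> point" where
  "collapse_up (Top i) = Up i" | "collapse_up (Mid i) = Lo i" | "collapse_up (Bot i) = Lo i"

fun collapse_down :: "point3 \<Rightarrow> point" where
  "collapse_down (Top i) = Up i" | "collapse_down (Mid i) = Up i" | "collapse_down (Bot i) = Lo i"

lemma collapse_simps [simp]:
  "collapse_up (top_mid x) = x" "collapse_up (top_bot x) = x"
  "collapse_down (mid_bot x) = x" "collapse_down (top_bot x) = x"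
  by (cases x; simp)+

text \<open>Collapsing the strands turns every linking path into a chain inside one block of
  \<open>p\<close>, or a trivial one. Conversely, two points of a block are linked between
  \<open>Top\<close> and \<open>Mid\<close>, and the strands lead on from \<open>Mid\<close> to
  \<open>Bot\<close>.\<close>

lemma compose_word_id_left:
  assumes "p \<in> colored_partitions" and "lower p = w"
  shows "compose (word_id w) p = p"
proof -
  let ?L = "linked (word_id w) p"
  note P = colored_partition_on[OF assms(1)]
  let ?R = "{(x, y). \<exists>B\<in>blocks p. x \<in> B \<and> y \<in> B}"
  have "(collapse_up a, collapse_up b) \<in> ?R\<^sup>=" if "(a, b) \<in> ?L" for a b
    using that
  proof (cases rule: linkedE)
    case (1 B x y)
    then have "(x, y) \<in> ?R" by blast
    then show ?thesis using 1 by simp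
  next
    case (2 B x y)
    then have "collapse_up a = collapse_up b" by auto
    then show ?thesis by simp
  qed
  moreover have "trans ?R"
    using equiv_partition_on[OF P] by (rule equivE)
  ultimately have sound: "(collapse_up a, collapse_up b) \<in> ?R\<^sup>=" if "(a, b) \<in> ?L\<^sup>*" for a b
    by (intro rtrancl_image_trans[OF that])
  \<comment> \<open>For an upper point both sides are the same \<open>Top\<close> point; a lower
    point is moved along its strand.\<close>
  have link: "(top_mid x, top_bot x) \<in> ?L\<^sup>*" if "x \<in> cpoints p" for x
  proof (cases x)
    case (Lo i)
    with that assms(2) show ?thesis
      using linked_upper[of "{Up i, Lo i}" "word_id w" "Up i" "Lo i" p] by (auto simp: cpoints_def)
  qed simp
  have "blocks (compose (word_id w) p) = blocks p"
  proof (rule blocks_compose_eqI)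
    show "partition_on (points (length (upper p)) (length (lower (word_id w)))) (blocks p)"
      using P assms(2) by (simp add: cpoints_def)
    fix x y
    assume "x \<in> points (length (upper p)) (length (lower (word_id w)))"
      and "y \<in> points (length (upper p)) (length (lower (word_id w)))"
    then have xy: "x \<in> cpoints p" "y \<in> cpoints p"
      using assms(2) by (simp_all add: cpoints_def)
    show "(top_bot x, top_bot y) \<in> ?L\<^sup>* \<longleftrightarrow> (\<exists>B\<in>blocks p. x \<in> B \<and> y \<in> B)"
    proof
      assume "(top_bot x, top_bot y) \<in> ?L\<^sup>*"
      from sound[OF this] show "\<exists>B\<in>blocks p. x \<in> B \<and> y \<in> B"
        using xy partition_onD1[OF P] by auto
    next
      assume "\<exists>B\<in>blocks p. x \<in> B \<and> y \<in> B"
      then have "(top_mid x, top_mid y) \<in> ?L\<^sup>*"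
        using linked_lower[of _ p x y] by blast
      moreover have "(top_bot x, top_mid x) \<in> ?L\<^sup>*"
        using link[OF xy(1)] by (rule symD[OF sym_rtrancl[OF sym_linked]])
      ultimately show "(top_bot x, top_bot y) \<in> ?L\<^sup>*"
        using link[OF xy(2)] by (blast intro: rtrancl_trans)
    qed
  qed
  then show ?thesis
    using assms(2) by (intro cpartition.expand) (simp del: compose_sel(3))
qed

text \<open>Mirror image of the previous argument, with the strands between \<open>Top\<close> and
  \<open>Mid\<close>.\<close>

lemma compose_word_id_right:
  assumes "q \<in> colored_partitions" and "upper q = w"
  shows "compose q (word_id w) = q"
proof -
  let ?L = "linked q (word_id w)"
  note P = colored_partition_on[OF assms(1)]
  let ?R = "{(x, y). \<exists>B\<in>blocks q. x \<in> B \<and> y \<in> B}"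
  have "(collapse_down a, collapse_down b) \<in> ?R\<^sup>=" if "(a, b) \<in> ?L" for a b
    using that
  proof (cases rule: linkedE)
    case (1 B x y)
    then have "collapse_down a = collapse_down b" by auto
    then show ?thesis by simp
  next
    case (2 B x y)
    then have "(x, y) \<in> ?R" by blast
    then show ?thesis using 2 by simp
  qed
  moreover have "trans ?R"
    using equiv_partition_on[OF P] by (rule equivE)
  ultimately have sound: "(collapse_down a, collapse_down b) \<in> ?R\<^sup>=" if "(a, b) \<in> ?L\<^sup>*" for a b
    by (intro rtrancl_image_trans[OF that])
  have link: "(mid_bot x, top_bot x) \<in> ?L\<^sup>*" if "x \<in> cpoints q" for x
  proof (cases x)
    case (Up i)
    with that assms(2) show ?thesis
      using linked_lower[of "{Up i, Lo i}" "word_id w" "Lo i" "Up i" q] by (auto simp: cpoints_def)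
  qed simp
  have "blocks (compose q (word_id w)) = blocks q"
  proof (rule blocks_compose_eqI)
    show "partition_on (points (length (upper (word_id w))) (length (lower q))) (blocks q)"
      using P assms(2) by (simp add: cpoints_def)
    fix x y
    assume "x \<in> points (length (upper (word_id w))) (length (lower q))"
      and "y \<in> points (length (upper (word_id w))) (length (lower q))"
    then have xy: "x \<in> cpoints q" "y \<in> cpoints q"
      using assms(2) by (simp_all add: cpoints_def)
    show "(top_bot x, top_bot y) \<in> ?L\<^sup>* \<longleftrightarrow> (\<exists>B\<in>blocks q. x \<in> B \<and> y \<in> B)"
    proof
      assume "(top_bot x, top_bot y) \<in> ?L\<^sup>*"
      from sound[OF this] show "\<exists>B\<in>blocks q. x \<in> B \<and> y \<in> B"
        using xy partition_onD1[OF P] by auto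
    next
      assume "\<exists>B\<in>blocks q. x \<in> B \<and> y \<in> B"
      then have "(mid_bot x, mid_bot y) \<in> ?L\<^sup>*"
        using linked_upper[of _ q x y] by blast
      moreover have "(top_bot x, mid_bot x) \<in> ?L\<^sup>*"
        using link[OF xy(1)] by (rule symD[OF sym_rtrancl[OF sym_linked]])
      ultimately show "(top_bot x, top_bot y) \<in> ?L\<^sup>*"
        using link[OF xy(2)] by (blast intro: rtrancl_trans)
    qed
  qed
  then show ?thesis
    using assms(2) by (intro cpartition.expand) (simp del: compose_sel(3))
qed

lemma involution_word_id: "involution (word_id w) = word_id w"
  by (rule cpartition.expand) (auto simp: image_image insert_commute)

lemma tensor_word_id: "tensor (word_id u) (word_id v) = word_id (u @ v)"
proof -
  have "{..<length u + length v} = {..<length u} \<union> (\<lambda>i. length u + i) ` {..<length v}"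
    unfolding lessThan_atLeast0 by (simp add: ivl_disj_un add.commute)
  then show ?thesis
    by (intro cpartition.expand) (simp add: image_Un image_image)
qed

lemma color_inversion_word_id: "color_inversion (word_id w) = word_id (map swap_color w)"
  by (rule cpartition.expand) simp

lemma shift_0: "shift 0 0 x = x"
  by (cases x) auto

lemma tensor_word_id_Nil: "tensor p (word_id []) = p" "tensor (word_id []) p = p"
  by (rule cpartition.expand; simp add: shift_0)+

subsection \<open>Properties of F\<close>

lemma upt_Suc_conv: "[0..<Suc n] = 0 # map Suc [0..<n]"
  by (simp add: map_Suc_upt upt_conv_Cons)

lemma swap_color_swap_color [simp]: "swap_color (swap_color c) = c"
  by (cases c) auto

lemma map_swap_color_swap_color [simp]: "map swap_color (map swap_color w) = w"
  by (simp add: comp_def)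

lemma color_inversion_color_inversion [simp]: "color_inversion (color_inversion p) = p"
  by (rule cpartition.expand) (simp add: comp_def)

text \<open>Removing the first letter moves all later positions by one and so exchanges the
  alternating colors. This turns the positional definition into a recursion on the word.\<close>

lemma F_word_simps [simp]:
  "F_word [] = []"
  "F_word (Ell # w) = White # map swap_color (F_word w)"
  "F_word (Triangle # w) = map swap_color (F_word w)"
  by (auto simp: F_word_def upt_Suc_conv filter_map comp_def simp del: upt_Suc)

text \<open>The coloring of \<open>v\<close> starts at position \<open>length u\<close>; an odd
  offset exchanges the two colors. This is the origin of the inversion in
  \<open>F_map_tensor\<close>.\<close>

lemma F_word_append:
  "F_word (u @ v) = F_word u @ (if even (length u) then F_word v else map swap_color (F_word v))"
proof (induction u)
  case (Cons c u)
  then show ?case by (cases c) (auto simp: comp_def)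
qed simp

lemma new_position_Cons [simp]:
  "new_position (c # w) 0 = 0"
  "new_position (c # w) (Suc i) = (if c = Ell then Suc (new_position w i) else new_position w i)"
  by (auto simp: new_position_def)

lemma length_F_word: "length (F_word w) = length (filter (\<lambda>c. c = Ell) w)"
proof (induction w)
  case (Cons c w)
  then show ?case by (cases c) auto
qed simp

lemma new_position_append:
  "i < length u \<Longrightarrow> new_position (u @ v) i = new_position u i"
  "new_position (u @ v) (length u + i) = length (F_word u) + new_position v i"
  by (simp_all add: new_position_def length_F_word)

text \<open>By induction on the word: a leading \<open>Ell\<close> takes the value 0 and raises all
  later values by one, while a leading triangle leaves them unchanged.\<close>

lemma bij_new_position:
  "bij_betw (new_position w) {i. i < length w \<and> w ! i = Ell} {..<length (F_word w)}"
proof (induction w)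
  case (Cons c w)
  let ?E = "\<lambda>w. {i. i < length w \<and> w ! i = Ell}"
  have inj: "inj_on (new_position w) (?E w)" and img: "new_position w ` ?E w = {..<length (F_word w)}"
    using Cons by (auto simp: bij_betw_def)
  have E: "?E (c # w) = (if c = Ell then {0} else {}) \<union> Suc ` ?E w"
    by (auto simp: image_iff less_Suc_eq_0_disj nth_Cons')
  have "inj_on (new_position (c # w)) (?E (c # w))"
    unfolding E using inj by (auto simp: inj_on_def)
  moreover have "new_position (c # w) ` ?E (c # w) = {..<length (F_word (c # w))}"
    unfolding E image_Un image_image
    by (cases c) (simp_all add: img[symmetric] lessThan_Suc_eq_insert_0 image_image)
  ultimately show ?case by (simp add: bij_betw_def)
qed (simp add: bij_betw_def)

section \<open>Points and blocks that survive under F\<close>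

definition ell_points :: "ecolor cpartition \<Rightarrow> point set" where
  "ell_points p = {x \<in> cpoints p. color p x = Ell}"

definition ell_blocks :: "ecolor cpartition \<Rightarrow> point set set" where
  "ell_blocks p = {B \<in> blocks p. \<forall>x\<in>B. color p x = Ell}"

lemma blocks_F_map [simp]: "blocks (F_map p) = (\<lambda>B. new_point p ` B) ` ell_blocks p"
  by (simp add: F_map_def ell_blocks_def)

lemma ell_points_conv:
  "ell_points p = Up ` {i. i < length (upper p) \<and> upper p ! i = Ell} \<union>
    Lo ` {i. i < length (lower p) \<and> lower p ! i = Ell}"
  by (auto simp: ell_points_def cpoints_def points_def)

lemma inj_on_new_point: "inj_on (new_point p) (ell_points p)"
  using bij_new_position[of "upper p"] bij_new_position[of "lower p"]
  by (auto simp: ell_points_conv bij_betw_def inj_on_def)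

lemma new_point_ell_points: "new_point p ` ell_points p = cpoints (F_map p)"
proof -
  have "new_point p ` ell_points p =
      Up ` new_position (upper p) ` {i. i < length (upper p) \<and> upper p ! i = Ell} \<union>
      Lo ` new_position (lower p) ` {i. i < length (lower p) \<and> lower p ! i = Ell}"
    by (simp add: ell_points_conv image_Un image_image)
  then show ?thesis
    using bij_new_position[of "upper p"] bij_new_position[of "lower p"]
    by (simp add: cpoints_def points_def bij_betw_def)
qed

lemma es_colored: "p \<in> es_partitions \<Longrightarrow> p \<in> colored_partitions"
  by (simp add: es_partitions_def)

lemma es_singleton:
  "p \<in> es_partitions \<Longrightarrow> x \<in> cpoints p \<Longrightarrow> color p x = Triangle \<Longrightarrow> {x} \<in> blocks p"
  by (simp add: es_partitions_def)

lemma es_triangle_alone: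
  assumes "p \<in> es_partitions" "B \<in> blocks p" "x \<in> B" "color p x = Triangle"
  shows "B = {x}"
proof -
  note P = colored_partition_on[OF es_colored[OF assms(1)]]
  have "{x} \<in> blocks p"
    using es_singleton[OF assms(1)] assms partition_onD1[OF P] by blast
  then show ?thesis
    using disjointD[OF partition_onD2[OF P]] assms by blast
qed

text \<open>No block mixes the two colors, since a triangle is already its whole block. One
  \<open>Ell\<close>-point thus suffices to recognize a block kept by \<open>F_map\<close>.\<close>

lemma es_ell_block:
  assumes "p \<in> es_partitions" "B \<in> blocks p" "x \<in> B" "color p x = Ell"
  shows "B \<in> ell_blocks p"
proof -
  have "color p y = Ell" if "y \<in> B" for y
    using es_triangle_alone[OF assms(1,2) that] assms(3,4) by (cases "color p y") auto
  then show ?thesis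
    using assms by (simp add: ell_blocks_def)
qed

text \<open>Separates the blocks visible to \<open>F_map\<close> from those dictated by the color
  patterns alone.\<close>

lemma blocks_es:
  assumes "p \<in> es_partitions"
  shows "blocks p = ell_blocks p \<union> (\<lambda>x. {x}) ` {x \<in> cpoints p. color p x = Triangle}"
proof (intro Set.equalityI subsetI)
  note P = colored_partition_on[OF es_colored[OF assms]]
  fix B assume B: "B \<in> blocks p"
  show "B \<in> ell_blocks p \<union> (\<lambda>x. {x}) ` {x \<in> cpoints p. color p x = Triangle}"
  proof (cases "\<forall>x\<in>B. color p x = Ell")
    case False
    then obtain x where x: "x \<in> B" "color p x = Triangle"
      using ecolor.exhaust by blast
    then show ?thesis
      using es_triangle_alone[OF assms B] B partition_onD1[OF P] by blast
  qed (simp add: B ell_blocks_def)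
qed (use assms in \<open>auto simp: ell_blocks_def es_partitions_def\<close>)

lemma partition_on_ell_blocks:
  assumes "p \<in> es_partitions"
  shows "partition_on (ell_points p) (ell_blocks p)"
proof (rule partition_onI)
  note P = colored_partition_on[OF es_colored[OF assms]]
  show "\<Union>(ell_blocks p) = ell_points p"
    using partition_onD1[OF P] es_ell_block[OF assms]
    by (fastforce simp: ell_points_def ell_blocks_def)
  show "disjnt A B" if "A \<in> ell_blocks p" "B \<in> ell_blocks p" "A \<noteq> B" for A B
    using that disjointD[OF partition_onD2[OF P]] by (auto simp: ell_blocks_def disjnt_def)
  show "{} \<notin> ell_blocks p"
    using partition_onD3[OF P] by (auto simp: ell_blocks_def)
qed

lemma F_map_colored: "p \<in> es_partitions \<Longrightarrow> F_map p \<in> colored_partitions"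
  using partition_on_image[OF partition_on_ell_blocks inj_on_new_point]
  by (simp add: colored_iff new_point_ell_points)

text \<open>The color patterns fix the extra singletons and the renumbering; as the latter is
  injective on \<open>Ell\<close>-points, the other blocks can be recovered from the image.\<close>

lemma F_map_inject:
  assumes "p \<in> es_partitions" "q \<in> es_partitions" "upper p = upper q" "lower p = lower q"
    and "F_map p = F_map q"
  shows "p = q"
proof -
  have color: "color p = color q"
  proof
    show "color p x = color q x" for x
      using assms(3,4) by (cases x) auto
  qed
  have new: "new_point p = new_point q"
  proof
    show "new_point p x = new_point q x" for x
      using assms(3,4) by (cases x) auto
  qed
  have cp: "cpoints p = cpoints q"
    using assms(3,4) by (simp add: cpoints_def)
  \<comment> \<open>Both families consist of subsets of \<open>ell_points p\<close>, and on these
    forming the image under \<open>new_point p\<close> is injective.\<close>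
  have "ell_blocks p \<subseteq> Pow (ell_points p)" "ell_blocks q \<subseteq> Pow (ell_points p)"
    using partition_onD1[OF partition_on_ell_blocks[OF assms(1)]]
      partition_onD1[OF partition_on_ell_blocks[OF assms(2)]]
    by (auto simp: ell_points_def cp color)
  moreover have "(\<lambda>B. new_point p ` B) ` ell_blocks p = (\<lambda>B. new_point p ` B) ` ell_blocks q"
    using blocks_F_map[of p] blocks_F_map[of q] assms(5) by (simp add: new)
  ultimately have "ell_blocks p = ell_blocks q"
    using inj_on_image_eq_iff[OF inj_on_image_Pow[OF inj_on_new_point[of p]]] by simp
  then have "blocks p = blocks q"
    using blocks_es[OF assms(1)] blocks_es[OF assms(2)] by (simp add: color cp)
  then show ?thesis
    using assms(3,4) by (intro cpartition.expand) simp
qed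

text \<open>The blocks of \<open>t\<close> are pulled back along the inverse of the renumbering, and
  every triangle of \<open>u\<close> and \<open>v\<close> is added as a singleton.\<close>

lemma F_map_surj:
  assumes "t \<in> colored_partitions" "F_word u = upper t" "F_word v = lower t"
  obtains p where "p \<in> es_partitions" "upper p = u" "lower p = v" "F_map p = t"
proof -
  \<comment> \<open>Points, colors and renumbering depend only on the color patterns, so a dummy
    without blocks gives access to them before \<open>p\<close> is built.\<close>
  define p0 where "p0 = CPartition u v {}"
  define g where "g = the_inv_into (ell_points p0) (new_point p0)"
  define T where "T = {x \<in> cpoints p0. color p0 x = Triangle}"
  define p where "p = CPartition u v ((\<lambda>B. g ` B) ` blocks t \<union> (\<lambda>x. {x}) ` T)"
  have new: "new_point p = new_point p0"
  proof
    show "new_point p x = new_point p0 x" for x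
      by (cases x) (simp_all add: p_def p0_def)
  qed
  have color: "color p = color p0"
  proof
    show "color p x = color p0 x" for x
      by (cases x) (simp_all add: p_def p0_def)
  qed
  have cp: "cpoints p = cpoints p0"
    by (simp add: p_def p0_def cpoints_def)
  have img: "new_point p0 ` ell_points p0 = cpoints t"
    using assms(2,3) by (simp add: new_point_ell_points cpoints_def p0_def)
  have inj: "inj_on g (cpoints t)" and g: "g ` cpoints t = ell_points p0"
    and inv: "\<And>x. x \<in> cpoints t \<Longrightarrow> new_point p0 (g x) = x"
    using inj_on_the_inv_into[OF inj_on_new_point[of p0]]
      the_inv_into_onto[OF inj_on_new_point[of p0]]
      f_the_inv_into_f[OF inj_on_new_point[of p0]]
    by (simp_all add: g_def img)
  note t = colored_partition_on[OF assms(1)]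
  have disj: "ell_points p0 \<inter> T = {}" and un: "ell_points p0 \<union> T = cpoints p0"
    by (auto simp: ell_points_def T_def intro: ecolor.exhaust[of "color p0 _"])
  have "partition_on (ell_points p0 \<union> T) (blocks p)"
    using partition_on_Un[OF partition_on_image[OF t inj] partition_on_singletons] disj
    by (simp add: p_def g)
  then have p: "p \<in> es_partitions"
    by (auto simp: es_partitions_def colored_iff cp color un) (simp add: p_def T_def)
  have sub: "B \<subseteq> cpoints t" "B \<noteq> {}" if "B \<in> blocks t" for B
    using that partition_onD1[OF t] partition_onD3[OF t] by auto
  have "ell_blocks p = (\<lambda>B. g ` B) ` blocks t"
  proof
    show "ell_blocks p \<subseteq> (\<lambda>B. g ` B) ` blocks t"
      unfolding ell_blocks_def color by (auto simp: p_def T_def)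
    show "(\<lambda>B. g ` B) ` blocks t \<subseteq> ell_blocks p"
      using sub(1) g unfolding ell_blocks_def color by (fastforce simp: p_def ell_points_def)
  qed
  moreover have "new_point p0 ` g ` B = B" if "B \<in> blocks t" for B
    using sub(1)[OF that] inv by (force simp: image_image)
  ultimately have "blocks (F_map p) = blocks t"
    by (simp add: new image_image)
  then have "F_map p = t"
    using assms(2,3) by (intro cpartition.expand) (simp add: p_def)
  with p show ?thesis
    by (intro that) (simp_all add: p_def)
qed

section \<open>Compatibility of F with involution and tensor product\<close>

lemma color_involution [simp]: "color (involution p) (swap_rows x) = color p x"
  by (cases x) auto

lemma cpoints_involution: "cpoints (involution p) = swap_rows ` cpoints p"
  by (simp add: cpoints_def swap_rows_points)

lemma es_involution:
  assumes "p \<in> es_partitions"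
  shows "involution p \<in> es_partitions"
proof -
  have "{x} \<in> blocks (involution p)"
    if x: "x \<in> cpoints (involution p)" and tri: "color (involution p) x = Triangle" for x
  proof -
    obtain y where y: "x = swap_rows y" "y \<in> cpoints p"
      using x unfolding cpoints_involution by blast
    then have "{y} \<in> blocks p"
      using tri y es_singleton[OF assms] by simp
    then show ?thesis
      using y by (auto simp: image_iff intro!: bexI[of _ "{y}"])
  qed
  then show ?thesis
    using involution_colored[OF es_colored[OF assms]] by (simp add: es_partitions_def)
qed

lemma new_point_involution: "new_point (involution p) (swap_rows x) = swap_rows (new_point p x)"
  by (cases x) auto

lemma F_map_involution: "F_map (involution p) = involution (F_map p)"
proof (rule cpartition.expand)
  have "ell_blocks (involution p) = (\<lambda>B. swap_rows ` B) ` ell_blocks p"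
    by (auto simp: ell_blocks_def)
  then show "upper (F_map (involution p)) = upper (involution (F_map p)) \<and>
      lower (F_map (involution p)) = lower (involution (F_map p)) \<and>
      blocks (F_map (involution p)) = blocks (involution (F_map p))"
    by (simp add: image_image new_point_involution)
qed

lemma color_tensor:
  "x \<in> cpoints p \<Longrightarrow> color (tensor p q) x = color p x"
  "color (tensor p q) (shift (length (upper p)) (length (lower p)) x) = color q x"
  by (cases x; simp add: cpoints_def nth_append)+

lemma cpoints_tensor:
  "cpoints (tensor p q) =
    cpoints p \<union> shift (length (upper p)) (length (lower p)) ` cpoints q"
  by (simp add: cpoints_def points_add)

lemma es_tensor:
  assumes "p \<in> es_partitions" "q \<in> es_partitions"
  shows "tensor p q \<in> es_partitions"
proof -
  have "{x} \<in> blocks (tensor p q)"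
    if "x \<in> cpoints (tensor p q)" "color (tensor p q) x = Triangle" for x
    using that(1) unfolding cpoints_tensor
  proof
    assume "x \<in> cpoints p"
    then show ?thesis
      using that(2) es_singleton[OF assms(1)] by (simp add: color_tensor)
  next
    assume "x \<in> shift (length (upper p)) (length (lower p)) ` cpoints q"
    then obtain y where y: "y \<in> cpoints q" "x = shift (length (upper p)) (length (lower p)) y"
      by blast
    then have "{y} \<in> blocks q"
      using that(2) es_singleton[OF assms(2)] by (simp add: color_tensor)
    then show ?thesis
      using y by (auto simp: image_iff intro!: bexI[of _ "{y}"])
  qed
  then show ?thesis
    using tensor_colored[OF es_colored es_colored, OF assms] by (simp add: es_partitions_def)
qed

lemma new_point_tensor:
  "x \<in> cpoints p \<Longrightarrow> new_point (tensor p q) x = new_point p x"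
  "new_point (tensor p q) (shift (length (upper p)) (length (lower p)) x) =
    shift (length (F_word (upper p))) (length (F_word (lower p))) (new_point q x)"
  by (cases x; simp add: cpoints_def new_position_append)+

text \<open>Even length gives both rows of \<open>p\<close> the same parity, so the alternating
  coloring of \<open>q\<close> is offset alike in both rows: either all its colors stay or all are
  inverted.\<close>

lemma F_map_tensor:
  assumes "p \<in> colored_partitions" "even (total_length p)"
  shows "F_map (tensor p q) =
    tensor (F_map p) (if even (length (upper p)) then F_map q else color_inversion (F_map q))"
    (is "_ = ?rhs")
proof -
  let ?s = "shift (length (upper p)) (length (lower p))"
  have sub: "B \<subseteq> cpoints p" if "B \<in> blocks p" for B
    using that partition_onD1[OF colored_partition_on[OF assms(1)]] by blast
  have "ell_blocks (tensor p q) = ell_blocks p \<union> (\<lambda>B. ?s ` B) ` ell_blocks q"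
    using sub by (auto simp: ell_blocks_def color_tensor subset_iff)
  moreover have "(\<lambda>B. new_point (tensor p q) ` B) ` ell_blocks p = (\<lambda>B. new_point p ` B) ` ell_blocks p"
    using sub by (intro image_cong refl) (auto simp: ell_blocks_def new_point_tensor subset_iff)
  ultimately have "blocks (F_map (tensor p q)) = blocks ?rhs"
    by (simp add: image_Un image_image new_point_tensor)
  moreover have "even (length (upper p)) \<longleftrightarrow> even (length (lower p))"
    using assms(2) by (auto simp: total_length_def)
  ultimately show ?thesis
    by (intro cpartition.expand) (simp add: F_word_append)
qed

section \<open>Compatibility of F with composition\<close>

context
  fixes p q :: "ecolor cpartition"
  assumes p: "p \<in> es_partitions" and q: "q \<in> es_partitions" and match: "lower p = upper q"
begin

text \<open>Colors on the three-row diagram. The row \<open>Mid\<close> belongs to both factors and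
  may be read from \<open>p\<close> by \<open>match\<close>.\<close>

fun color3 :: "point3 \<Rightarrow> ecolor" where
  "color3 (Top i) = upper p ! i" | "color3 (Mid i) = lower p ! i" | "color3 (Bot i) = lower q ! i"

fun new_point3 :: "point3 \<Rightarrow> point3" where
  "new_point3 (Top i) = Top (new_position (upper p) i)"
| "new_point3 (Mid i) = Mid (new_position (lower p) i)"
| "new_point3 (Bot i) = Bot (new_position (lower q) i)"

definition ell_points3 :: "point3 set" where
  "ell_points3 = top_mid ` ell_points p \<union> mid_bot ` ell_points q"

lemma color3_row [simp]:
  "color3 (top_mid x) = color p x" "color3 (mid_bot x) = color q x"
  "color3 (top_bot x) = color (compose q p) x"
  by (cases x; simp add: match)+

lemma new_point3_row [simp]:
  "new_point3 (top_mid x) = top_mid (new_point p x)"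
  "new_point3 (mid_bot x) = mid_bot (new_point q x)"
  "new_point3 (top_bot x) = top_bot (new_point (compose q p) x)"
  by (cases x; simp add: match)+

lemma ell_points3_conv:
  "ell_points3 = Top ` {i. i < length (upper p) \<and> upper p ! i = Ell} \<union>
    Mid ` {i. i < length (lower p) \<and> lower p ! i = Ell} \<union>
    Bot ` {i. i < length (lower q) \<and> lower q ! i = Ell}"
  by (auto simp: ell_points3_def ell_points_conv image_Un image_image match)

lemma top_bot_ell_points: "x \<in> ell_points (compose q p) \<Longrightarrow> top_bot x \<in> ell_points3"
  by (auto simp: ell_points3_conv ell_points_conv)

lemma inj_on_new_point3: "inj_on new_point3 ell_points3"
  using bij_new_position[of "upper p"] bij_new_position[of "lower p"] bij_new_position[of "lower q"]
  by (auto simp: ell_points3_conv bij_betw_def inj_on_def)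

text \<open>A triangle in the middle row is a singleton in both factors, so it is isolated in the
  diagram; an outer one is so in its own factor.\<close>

lemma linked_triangle:
  assumes "(a, b) \<in> linked q p" "color3 a = Triangle"
  shows "b = a"
  using assms(1)
proof (cases rule: linkedE)
  case (1 B x y)
  then show ?thesis using es_triangle_alone[OF p, of B x] assms(2) by auto
next
  case (2 B x y)
  then show ?thesis using es_triangle_alone[OF q, of B x] assms(2) by auto
qed

lemma linked_triangle_star:
  assumes "(a, b) \<in> (linked q p)\<^sup>*" "color3 a = Triangle"
  shows "b = a"
  using assms by (induction rule: rtrancl_induct) (auto dest: linked_triangle)

text \<open>A path ending at a triangle is trivial when read backwards.\<close>

lemma linked_ell_star:
  assumes "(a, b) \<in> (linked q p)\<^sup>*" "color3 a = Ell"
  shows "color3 b = Ell"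
  using linked_triangle_star[of b a] symD[OF sym_rtrancl[OF sym_linked] assms(1)] assms(2)
  by (cases "color3 b") auto

lemma ell_blocks_sub: "B \<in> ell_blocks p \<Longrightarrow> x \<in> B \<Longrightarrow> top_mid x \<in> ell_points3"
  "B \<in> ell_blocks q \<Longrightarrow> x \<in> B \<Longrightarrow> mid_bot x \<in> ell_points3"
  using partition_onD1[OF partition_on_ell_blocks[OF p]] partition_onD1[OF partition_on_ell_blocks[OF q]]
  by (auto simp: ell_points3_def)

lemma linked_new_point3:
  assumes "(a, b) \<in> linked q p" "a \<in> ell_points3"
  shows "b \<in> ell_points3 \<and> (new_point3 a, new_point3 b) \<in> linked (F_map q) (F_map p)"
proof -
  have ell: "color3 a = Ell"
    using assms(2) by (auto simp: ell_points3_conv)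
  show ?thesis
    using assms(1)
  proof (cases rule: linkedE)
    case (1 B x y)
    then have B: "B \<in> ell_blocks p"
      using es_ell_block[OF p] ell by auto
    then have "new_point p ` B \<in> blocks (F_map p)" by simp
    from linked_lower[OF this, of "new_point p x" "new_point p y" "F_map q"] show ?thesis
      using 1 ell_blocks_sub(1)[OF B] by simp
  next
    case (2 B x y)
    then have B: "B \<in> ell_blocks q"
      using es_ell_block[OF q] ell by auto
    then have "new_point q ` B \<in> blocks (F_map q)" by simp
    from linked_upper[OF this, of "new_point q x" "new_point q y" "F_map p"] show ?thesis
      using 2 ell_blocks_sub(2)[OF B] by simp
  qed
qed

lemma linked_F_mapE:
  assumes "(a', b') \<in> linked (F_map q) (F_map p)"
  obtains a b where "a \<in> ell_points3" "b \<in> ell_points3" "a' = new_point3 a" "b' = new_point3 b"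
    "(a, b) \<in> linked q p"
  using assms
proof (cases rule: linkedE)
  case (1 B' x' y')
  then obtain B x y where *: "B \<in> ell_blocks p" "x \<in> B" "y \<in> B" "x' = new_point p x" "y' = new_point p y"
    by auto
  show ?thesis
  proof (rule that)
    show "top_mid x \<in> ell_points3" "top_mid y \<in> ell_points3"
      using * ell_blocks_sub by blast+
    show "(top_mid x, top_mid y) \<in> linked q p"
      using * linked_lower[of B p x y q] by (auto simp: ell_blocks_def)
  qed (use * 1 in simp_all)
next
  case (2 B' x' y')
  then obtain B x y where *: "B \<in> ell_blocks q" "x \<in> B" "y \<in> B" "x' = new_point q x" "y' = new_point q y"
    by auto
  show ?thesis
  proof (rule that)
    show "mid_bot x \<in> ell_points3" "mid_bot y \<in> ell_points3"
      using * ell_blocks_sub by blast+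
    show "(mid_bot x, mid_bot y) \<in> linked q p"
      using * linked_upper[of B q x y p] by (auto simp: ell_blocks_def)
  qed (use * 2 in simp_all)
qed

text \<open>A path from an \<open>Ell\<close>-point never meets a triangle and is mapped link by
  link. Conversely each link of the images lifts, and injectivity of \<open>new_point3\<close> makes
  the lifted link start where the path lifted so far ends.\<close>

lemma linked_star_new_point3:
  assumes "a \<in> ell_points3" "b \<in> ell_points3"
  shows "(a, b) \<in> (linked q p)\<^sup>* \<longleftrightarrow> (new_point3 a, new_point3 b) \<in> (linked (F_map q) (F_map p))\<^sup>*"
proof
  assume "(a, b) \<in> (linked q p)\<^sup>*"
  then have "b \<in> ell_points3 \<and> (new_point3 a, new_point3 b) \<in> (linked (F_map q) (F_map p))\<^sup>*"
  proof (induction rule: rtrancl_induct)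
    case (step b c)
    then show ?case
      using linked_new_point3[of b c] by (meson rtrancl.rtrancl_into_rtrancl)
  qed (simp add: assms)
  then show "(new_point3 a, new_point3 b) \<in> (linked (F_map q) (F_map p))\<^sup>*" ..
next
  have "\<exists>b\<in>ell_points3. b' = new_point3 b \<and> (a, b) \<in> (linked q p)\<^sup>*"
    if "(new_point3 a, b') \<in> (linked (F_map q) (F_map p))\<^sup>*" for b'
    using that
  proof (induction rule: rtrancl_induct)
    case base
    then show ?case using assms(1) by blast
  next
    case (step b' c')
    obtain b where b: "b \<in> ell_points3" "b' = new_point3 b" "(a, b) \<in> (linked q p)\<^sup>*"
      using step.IH by blast
    obtain d c where c: "d \<in> ell_points3" "c \<in> ell_points3" "b' = new_point3 d" "c' = new_point3 c"
      "(d, c) \<in> linked q p"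
      using linked_F_mapE[OF step.hyps(2)] by blast
    have "d = b"
      using inj_onD[OF inj_on_new_point3] b c by metis
    then have "(a, c) \<in> (linked q p)\<^sup>*"
      using b(3) c(5) by (simp add: rtrancl_into_rtrancl)
    then show ?case
      using c(2,4) by blast
  qed
  moreover assume "(new_point3 a, new_point3 b) \<in> (linked (F_map q) (F_map p))\<^sup>*"
  ultimately show "(a, b) \<in> (linked q p)\<^sup>*"
    using inj_onD[OF inj_on_new_point3] assms(2) by metis
qed

lemma comp_rel_triangle:
  assumes "(x, y) \<in> comp_rel q p" "color (compose q p) x = Triangle"
  shows "y = x"
  using linked_triangle_star[of "top_bot x" "top_bot y"] assms by (auto simp: comp_rel_def dest: inj_top_bot)

lemma comp_rel_ell:
  assumes "(x, y) \<in> comp_rel q p" "color (compose q p) x = Ell"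
  shows "color (compose q p) y = Ell"
  using linked_ell_star[of "top_bot x" "top_bot y"] assms by (auto simp: comp_rel_def)

lemma es_compose: "compose q p \<in> es_partitions"
proof -
  have "{x} \<in> blocks (compose q p)"
    if "x \<in> cpoints (compose q p)" "color (compose q p) x = Triangle" for x
  proof -
    have "(x, x) \<in> comp_rel q p"
      using that(1) by (simp add: comp_rel_def cpoints_def)
    then have "comp_rel q p `` {x} = {x}"
      using comp_rel_triangle[OF _ that(2)] by blast
    then show ?thesis
      using that(1) quotientI[of x _ "comp_rel q p"] by (simp add: cpoints_def)
  qed
  then show ?thesis
    using compose_colored by (simp add: es_partitions_def)
qed

text \<open>The classes of the joining relation never mix colors, so the kept blocks are the classes
  of \<open>Ell\<close>-points; \<open>new_point\<close> carries them to the classes obtained by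
  joining the images.\<close>

lemma F_map_compose: "F_map (compose q p) = compose (F_map q) (F_map p)"
proof (rule cpartition.expand)
  let ?V = "points (length (upper p)) (length (lower q))"
  let ?E = "ell_points (compose q p)"
  let ?B = "points (length (upper (F_map p))) (length (lower (F_map q)))"
  have cp: "cpoints (compose q p) = ?V"
    by (simp add: cpoints_def)
  have E: "?E \<subseteq> ?V"
    by (auto simp: ell_points_def cp)
  have B: "new_point (compose q p) ` ?E = ?B"
    by (simp add: new_point_ell_points cpoints_def)
  have closed: "comp_rel q p `` {x} \<subseteq> ?E" if "x \<in> ?E" for x
    using that comp_rel_ell[of x] by (auto simp: ell_points_def cp) (simp add: comp_rel_def)
  have "ell_blocks (compose q p) = ?E // comp_rel q p"
  proof (intro Set.equalityI subsetI)
    fix X assume X: "X \<in> ell_blocks (compose q p)"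
    then obtain x where x: "x \<in> ?V" "X = comp_rel q p `` {x}"
      by (auto simp: ell_blocks_def quotient_def)
    then have "x \<in> X"
      by (simp add: comp_rel_def)
    then have "x \<in> ?E"
      using X x(1) by (auto simp: ell_blocks_def ell_points_def cp)
    then show "X \<in> ?E // comp_rel q p"
      using x(2) by (simp add: quotientI)
  next
    fix X assume "X \<in> ?E // comp_rel q p"
    then obtain x where x: "x \<in> ?E" "X = comp_rel q p `` {x}"
      by (auto simp: quotient_def)
    then show "X \<in> ell_blocks (compose q p)"
      using closed[OF x(1)] E quotientI[of x ?V "comp_rel q p"]
      by (auto simp: ell_blocks_def ell_points_def)
  qed
  moreover have "(\<lambda>X. new_point (compose q p) ` X) ` (?E // comp_rel q p) = ?B // comp_rel (F_map q) (F_map p)"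
  proof (rule image_quotient_eq[OF B closed])
    show "comp_rel (F_map q) (F_map p) \<subseteq> ?B \<times> ?B"
      by (auto simp: comp_rel_def)
    fix x y assume xy: "x \<in> ?E" "y \<in> ?E"
    then have "new_point (compose q p) x \<in> ?B" "new_point (compose q p) y \<in> ?B" "x \<in> ?V" "y \<in> ?V"
      using B E by blast+
    then show "(x, y) \<in> comp_rel q p \<longleftrightarrow>
        (new_point (compose q p) x, new_point (compose q p) y) \<in> comp_rel (F_map q) (F_map p)"
      using linked_star_new_point3[OF top_bot_ell_points top_bot_ell_points, OF xy]
      by (simp add: comp_rel_def)
  qed
  ultimately show "upper (F_map (compose q p)) = upper (compose (F_map q) (F_map p)) \<and>
      lower (F_map (compose q p)) = lower (compose (F_map q) (F_map p)) \<and>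
      blocks (F_map (compose q p)) = blocks (compose (F_map q) (F_map p))"
    by simp
qed

end

section \<open>Even length, generators and preimages\<close>

lemma es_evenD: "p \<in> es_partitions_even \<Longrightarrow> p \<in> es_partitions"
  "p \<in> es_partitions_even \<Longrightarrow> even (total_length p)"
  by (simp_all add: es_partitions_even_def)

lemma F_map_tensor_even:
  assumes "p \<in> es_partitions_even"
  shows "F_map (tensor p q) =
    tensor (F_map p) (if even (length (upper p)) then F_map q else color_inversion (F_map q))"
  using F_map_tensor[OF es_colored[OF es_evenD(1)] es_evenD(2), OF assms assms] .

text \<open>In a composition the inner row is counted once in each factor, so its removal keeps the
  parity of the sum of lengths.\<close>

lemma closed_even: "closed_under_operations es_partitions_even"
proof -
  have "compose q p \<in> es_partitions_even"
    if "p \<in> es_partitions_even" "q \<in> es_partitions_even" "lower p = upper q" for p q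
    using that es_compose[of p q] by (auto simp: es_partitions_even_def total_length_def)
  moreover have "tensor p q \<in> es_partitions_even"
    if "p \<in> es_partitions_even" "q \<in> es_partitions_even" for p q
    using that es_tensor[of p q] by (auto simp: es_partitions_even_def total_length_def)
  moreover have "involution p \<in> es_partitions_even" if "p \<in> es_partitions_even" for p
    using that es_involution[of p] by (auto simp: es_partitions_even_def total_length_def)
  ultimately show ?thesis by (simp add: closed_under_operations_def)
qed

text \<open>Only one color variant of each two-colored generator arises here; color inversion
  supplies the other. Both triangle generators become the empty partition.\<close>

lemma F_map_generators:
  "F_map (CPartition [Ell] [Ell] {{Up 0, Lo 0}}) = CPartition [White] [White] {{Up 0, Lo 0}}"
  "F_map (CPartition [Triangle] [Triangle] {{Up 0}, {Lo 0}}) = word_id []"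
  "F_map (CPartition [] [Ell, Ell] {{Lo 0, Lo 1}}) = CPartition [] [White, Black] {{Lo 0, Lo 1}}"
  "F_map (CPartition [] [Triangle, Triangle] {{Lo 0}, {Lo 1}}) = word_id []"
  by (rule cpartition.expand; auto simp: ell_blocks_def)+

lemma generators_even:
  "CPartition [Ell] [Ell] {{Up 0, Lo 0}} \<in> es_partitions_even"
  "CPartition [Triangle] [Triangle] {{Up 0}, {Lo 0}} \<in> es_partitions_even"
  "CPartition [] [Ell, Ell] {{Lo 0, Lo 1}} \<in> es_partitions_even"
  "CPartition [] [Triangle, Triangle] {{Lo 0}, {Lo 1}} \<in> es_partitions_even"
  by (auto simp: es_partitions_even_def es_partitions_def colored_iff cpoints_def points_def
      total_length_def partition_on_def disjoint_def lessThan_Suc)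

text \<open>Each color is encoded by two letters, so the alternation starts again with
  \<open>White\<close>: \<open>Ell\<close> before a triangle gives \<open>White\<close>, after a
  triangle \<open>Black\<close>.\<close>

lemma F_word_surj: "\<exists>w. F_word w = v"
proof (induction v)
  case (Cons c v)
  then obtain w where w: "F_word w = v" by blast
  show ?case
  proof (cases c)
    case White
    then have "F_word (Ell # Triangle # w) = c # v"
      using w by (simp add: comp_def)
    then show ?thesis by blast
  next
    case Black
    then have "F_word (Triangle # Ell # w) = c # v"
      using w by (simp add: comp_def)
    then show ?thesis by blast
  qed
qed (use F_word_simps(1) in blast)

lemma F_map_surj_even:
  assumes "t \<in> colored_partitions"
  obtains p where "p \<in> es_partitions_even" "F_map p = t"
proof -
  obtain u v where u: "F_word u = upper t" and v: "F_word v = lower t"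
    using F_word_surj by metis
  \<comment> \<open>A trailing triangle corrects the parity without affecting any color to its
    left.\<close>
  define v' where "v' = (if even (length u + length v) then v else v @ [Triangle])"
  have "F_word v' = lower t"
    using v by (simp add: v'_def F_word_append)
  with F_map_surj[OF assms u] obtain p
    where p: "p \<in> es_partitions" "upper p = u" "lower p = v'" "F_map p = t"
    by blast
  have "even (length u + length v')"
    by (simp add: v'_def)
  then show ?thesis
    using p by (intro that) (simp_all add: es_partitions_even_def total_length_def)
qed

subsection \<open>The correspondence of categories\<close>

context
  fixes C
  assumes cat: "es_category C" and sub: "C \<subseteq> es_partitions_even"
begin

lemma C_tensor: "p \<in> C \<Longrightarrow> q \<in> C \<Longrightarrow> tensor p q \<in> C"
  and C_compose: "p \<in> C \<Longrightarrow> q \<in> C \<Longrightarrow> lower p = upper q \<Longrightarrow> compose q p \<in> C"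
  and C_involution: "p \<in> C \<Longrightarrow> involution p \<in> C"
  and C_generators: "CPartition [Ell] [Ell] {{Up 0, Lo 0}} \<in> C"
    "CPartition [Triangle] [Triangle] {{Up 0}, {Lo 0}} \<in> C"
    "CPartition [] [Ell, Ell] {{Lo 0, Lo 1}} \<in> C"
    "CPartition [] [Triangle, Triangle] {{Lo 0}, {Lo 1}} \<in> C"
  using cat by (auto simp: es_category_def closed_under_operations_def)

lemma C_es: "p \<in> C \<Longrightarrow> p \<in> es_partitions"
  using sub by (auto simp: es_partitions_even_def)

lemma C_parity: "p \<in> C \<Longrightarrow> even (length (upper p)) \<longleftrightarrow> even (length (lower p))"
  using sub by (auto simp: es_partitions_even_def total_length_def)

lemma F_map_tensor_C: "p \<in> C \<Longrightarrow> F_map (tensor p q) =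
    tensor (F_map p) (if even (length (upper p)) then F_map q else color_inversion (F_map q))"
  using sub F_map_tensor_even by blast

text \<open>Composing with such an \<open>r\<close> changes a color pattern of an element of
  \<open>C\<close> but not its image under \<open>F_map\<close>.\<close>

definition joined :: "ecolor list \<Rightarrow> ecolor list \<Rightarrow> bool" where
  "joined u v \<longleftrightarrow> (\<exists>r\<in>C. upper r = u \<and> lower r = v \<and> F_map r = word_id (F_word u))"

lemma joined_F_word: "joined u v \<Longrightarrow> F_word u = F_word v"
  unfolding joined_def by (metis F_map_sel(2) word_id_sel(2))

lemma joined_sym:
  assumes "joined u v" shows "joined v u"
proof -
  obtain r where "r \<in> C" "upper r = u" "lower r = v" "F_map r = word_id (F_word u)"
    using assms by (auto simp: joined_def)
  then show ?thesis
    unfolding joined_def using C_involution[of r] joined_F_word[OF assms]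
    by (intro bexI[of _ "involution r"]) (simp_all add: F_map_involution involution_word_id)
qed

lemma joined_trans:
  assumes "joined u v" "joined v w" shows "joined u w"
proof -
  obtain r where r: "r \<in> C" "upper r = u" "lower r = v" "F_map r = word_id (F_word u)"
    using assms(1) by (auto simp: joined_def)
  obtain s where s: "s \<in> C" "upper s = v" "lower s = w" "F_map s = word_id (F_word v)"
    using assms(2) by (auto simp: joined_def)
  have "F_map (compose s r) = word_id (F_word u)"
    using r s F_map_compose[OF C_es C_es, of r s] joined_F_word[OF assms(1)]
      compose_word_id_left[OF word_id_colored, of "F_word u" "F_word u"] by simp
  then show ?thesis
    unfolding joined_def using r s C_compose[of r s] by (intro bexI[of _ "compose s r"]) simp_all
qed

lemma joined_append:
  assumes "joined u v" "joined u' v'" shows "joined (u @ u') (v @ v')"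
proof -
  obtain r where r: "r \<in> C" "upper r = u" "lower r = v" "F_map r = word_id (F_word u)"
    using assms(1) by (auto simp: joined_def)
  obtain s where s: "s \<in> C" "upper s = u'" "lower s = v'" "F_map s = word_id (F_word u')"
    using assms(2) by (auto simp: joined_def)
  have "F_map (tensor r s) = word_id (F_word (u @ u'))"
    using r s by (simp add: F_map_tensor_C F_word_append tensor_word_id color_inversion_word_id)
  then show ?thesis
    unfolding joined_def using r s C_tensor[of r s] by (intro bexI[of _ "tensor r s"]) simp_all
qed

lemma joined_single: "joined [c] [c]"
proof (cases c)
  case Ell
  have "F_map (CPartition [Ell] [Ell] {{Up 0, Lo 0}}) = word_id (F_word [Ell])"
    unfolding F_map_generators by (simp add: word_id_def lessThan_Suc)
  then show ?thesis
    unfolding joined_def Ell using C_generators(1) by (intro bexI) simp_all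
next
  case Triangle
  show ?thesis
    unfolding joined_def Triangle using C_generators(2) F_map_generators(2) by (intro bexI) simp_all
qed

lemma joined_triangles: "joined [] [Triangle, Triangle]"
  unfolding joined_def using C_generators(4) F_map_generators(4) by (intro bexI) simp_all

text \<open>The empty partition arises by creating two triangles and removing them again.\<close>

lemma joined_Nil: "joined [] []"
  using joined_trans[OF joined_triangles joined_sym[OF joined_triangles]] .

lemma joined_Cons: "joined u v \<Longrightarrow> joined (c # u) (c # v)"
  using joined_append[OF joined_single[of c], of u v] by simp

lemma joined_insert_triangles: "joined u v \<Longrightarrow> joined u (Triangle # Triangle # v)"
  using joined_append[OF joined_triangles, of u v] by simp

text \<open>For the converse, induction on the total length strips equal first letters and leading
  pairs of triangles. If the first letters differ, one word starts with \<open>Ell\<close>, hence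
  its image with \<open>White\<close>, and this forces the other word to start with two
  triangles.\<close>

lemma joined_iff:
  "joined u v \<longleftrightarrow> F_word u = F_word v \<and> even (length u + length v)"
proof
  assume "joined u v"
  then show "F_word u = F_word v \<and> even (length u + length v)"
    using joined_F_word C_parity by (auto simp: joined_def)
next
  assume "F_word u = F_word v \<and> even (length u + length v)"
  then show "joined u v"
  proof (induction "length u + length v" arbitrary: u v rule: less_induct)
    case less
    have TT: "joined u v" if "u = Triangle # Triangle # u'" for u'
      using joined_sym[OF joined_insert_triangles[OF joined_sym]] less.hyps[of u' v]
        less.prems that by (simp add: comp_def)
    have TT': "joined u v" if "v = Triangle # Triangle # v'" for v'
      using joined_insert_triangles less.hyps[of u v'] less.prems that by (simp add: comp_def)
    have inj: "map swap_color s = map swap_color t \<longleftrightarrow> s = t" for s t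
      by (metis map_swap_color_swap_color)
    \<comment> \<open>Here \<open>F_word v\<close> starts with \<open>Black\<close>, whereas a
      leading \<open>Ell\<close> would produce \<open>White\<close>.\<close>
    have starts: "\<exists>v'. v = Triangle # v'"
      if "map swap_color (F_word v) = White # s" "F_word v \<noteq> []" for v s
      using that
    proof (cases v)
      case (Cons c v')
      then show ?thesis using that by (cases c) auto
    qed simp
    show ?case
    proof (cases u)
      case Nil
      note u = Nil
      show ?thesis
      proof (cases v)
        case Nil
        then show ?thesis using u joined_Nil by simp
      next
        case (Cons c v')
        then have "c = Triangle"
          using less.prems u by (cases c) auto
        \<comment> \<open>A single triangle against the empty word is excluded by parity.\<close>
        moreover have "\<exists>d v''. v' = d # v''"
          using less.prems u Cons by (cases v') auto
        then obtain d v'' where "v' = d # v''" by blast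
        moreover have "d = Triangle"
          using less.prems u Cons \<open>c = Triangle\<close> \<open>v' = d # v''\<close> by (cases d) auto
        ultimately show ?thesis using TT' Cons by blast
      qed
    next
      case (Cons c u')
      note u = Cons
      show ?thesis
      proof (cases v)
        case Nil
        then have "c = Triangle"
          using less.prems u by (cases c) auto
        moreover have "\<exists>d u''. u' = d # u''"
          using less.prems u Nil by (cases u') auto
        then obtain d u'' where "u' = d # u''" by blast
        moreover have "d = Triangle"
          using less.prems u Nil \<open>c = Triangle\<close> \<open>u' = d # u''\<close> by (cases d) auto
        ultimately show ?thesis using TT u by blast
      next
        case (Cons d v')
        show ?thesis
        proof (cases "c = d")
          case True
          have "F_word u' = F_word v'"
            using less.prems u Cons True inj by (cases d) auto
          then show ?thesis
            using less.hyps[of u' v'] less.prems u Cons True joined_Cons by simp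
        next
          case False
          then consider "c = Ell" "d = Triangle" | "c = Triangle" "d = Ell"
            by (cases c; cases d) auto
          then show ?thesis
          proof cases
            case 1
            then obtain v'' where "v' = Triangle # v''"
              using starts[of v'] less.prems u Cons by (metis F_word_simps list.distinct(1) list.simps(8))
            then show ?thesis using TT' Cons 1 by simp
          next
            case 2
            then obtain u'' where "u' = Triangle # u''"
              using starts[of u'] less.prems u Cons by (metis F_word_simps list.distinct(1) list.simps(8))
            then show ?thesis using TT u 2 by simp
          qed
        qed
      qed
    qed
  qed
qed

text \<open>Adding the triangle identity on the right lengthens each row by one and leaves the image
  unchanged.\<close>

lemma adjust_parity:
  assumes "p \<in> C"
  obtains p' where "p' \<in> C" "F_map p' = F_map p" "even (length (lower p')) \<longleftrightarrow> b"
proof (cases "even (length (lower p)) \<longleftrightarrow> b")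
  case True
  then show ?thesis using that assms by blast
next
  case False
  let ?i = "CPartition [Triangle] [Triangle] {{Up 0}, {Lo 0}}"
  have "F_map (tensor p ?i) = F_map p"
    using F_map_tensor_C[OF assms, of ?i]
    by (simp add: F_map_generators color_inversion_word_id tensor_word_id_Nil)
  then show ?thesis
    using that[of "tensor p ?i"] C_tensor[OF assms C_generators(2)] False by simp
qed

text \<open>The triangle identity on the left has empty image but rows of odd length, so it only
  inverts the colors of \<open>p\<close>.\<close>

lemma color_inversion_F_image:
  assumes "t \<in> F_map ` C"
  shows "color_inversion t \<in> F_map ` C"
proof -
  obtain p where p: "p \<in> C" "t = F_map p"
    using assms by blast
  let ?i = "CPartition [Triangle] [Triangle] {{Up 0}, {Lo 0}}"
  have "F_map (tensor ?i p) = color_inversion t"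
    using F_map_tensor_C[OF C_generators(2), of p] p(2)
    by (simp add: F_map_generators tensor_word_id_Nil del: tensor_sel)
  then show ?thesis
    using C_tensor[OF C_generators(2) p(1)] by (metis imageI)
qed

text \<open>Color inversion is its own inverse, so closure under it gives equality.\<close>

lemma invariant_F_image: "color_inversion_invariant (F_map ` C)"
  unfolding color_inversion_invariant_def
proof
  show "color_inversion ` F_map ` C \<subseteq> F_map ` C"
    using color_inversion_F_image by blast
  then show "F_map ` C \<subseteq> color_inversion ` F_map ` C"
    using color_inversion_F_image color_inversion_color_inversion by (metis imageI subsetI)
qed

lemma closed_F_image: "closed_under_operations (F_map ` C)"
proof -
  have "involution (F_map p) \<in> F_map ` C" if "p \<in> C" for p
    using C_involution[OF that] F_map_involution by (metis imageI)
  moreover have "tensor (F_map p) (F_map q) \<in> F_map ` C" if p: "p \<in> C" and q: "q \<in> C" for p q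
  proof -
    \<comment> \<open>With rows of even length in the first factor the colors of the second one are
      kept.\<close>
    obtain p' where p': "p' \<in> C" "F_map p' = F_map p" "even (length (lower p'))"
      using adjust_parity[OF p, of True] by auto
    have "F_map (tensor p' q) = tensor (F_map p) (F_map q)"
      using p' F_map_tensor_C[OF p'(1)] C_parity by simp
    then show ?thesis
      using C_tensor[OF p'(1) q] by (metis imageI)
  qed
  moreover have "compose (F_map q) (F_map p) \<in> F_map ` C"
    if p: "p \<in> C" and q: "q \<in> C" and match: "lower (F_map p) = upper (F_map q)" for p q
  proof -
    \<comment> \<open>The patterns to be matched have equal images; equal parity of their lengths is
      what \<open>joined_iff\<close> further asks for.\<close>
    obtain p' where p': "p' \<in> C" "F_map p' = F_map p" "even (length (lower p')) = even (length (upper q))"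
      using adjust_parity[OF p] by metis
    have word: "F_word (lower p') = F_word (upper q)"
      using match p'(2) by (metis F_map_sel)
    then have "joined (lower p') (upper q)"
      using p'(3) by (simp add: joined_iff)
    then obtain r where r: "r \<in> C" "upper r = lower p'" "lower r = upper q"
      "F_map r = word_id (F_word (lower p'))"
      by (auto simp: joined_def)
    have rp: "compose r p' \<in> C"
      using C_compose p'(1) r by simp
    \<comment> \<open>Under \<open>F_map\<close> the connecting partition \<open>r\<close> is an
      identity.\<close>
    have "F_map (compose r p') = F_map p"
      using F_map_compose[OF C_es[OF p'(1)] C_es[OF r(1)]] r p'(2)
        compose_word_id_left[OF F_map_colored[OF C_es[OF p'(1)]] F_map_sel(2)] by simp
    then have "F_map (compose q (compose r p')) = compose (F_map q) (F_map p)"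
      using F_map_compose[OF C_es[OF rp] C_es[OF q]] r by simp
    moreover have "compose q (compose r p') \<in> C"
      using C_compose[OF rp q] r by simp
    ultimately show ?thesis by (metis imageI)
  qed
  ultimately show ?thesis
    by (auto simp: closed_under_operations_def simp del: F_map_sel)
qed

lemma tc_category_F_image: "tc_category (F_map ` C)"
proof -
  have W: "CPartition [White] [White] {{Up 0, Lo 0}} \<in> F_map ` C"
    using C_generators(1) F_map_generators(1) by (metis imageI)
  have WB: "CPartition [] [White, Black] {{Lo 0, Lo 1}} \<in> F_map ` C"
    using C_generators(3) F_map_generators(3) by (metis imageI)
  have "F_map ` C \<subseteq> tc_partitions"
    using F_map_colored C_es by (auto simp: tc_partitions_def)
  then show ?thesis
    using closed_F_image W WB color_inversion_F_image[OF W] color_inversion_F_image[OF WB]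
    by (simp add: tc_category_def color_inversion_def)
qed

text \<open>An element of \<open>C\<close> with the image of \<open>p\<close> is composed above and
  below with connecting partitions until it has the patterns of \<open>p\<close>; by
  \<open>F_map_inject\<close> it is then \<open>p\<close> itself.\<close>

lemma F_preimage_F_image: "F_preimage (F_map ` C) = C"
proof
  show "C \<subseteq> F_preimage (F_map ` C)"
    using sub by (auto simp: F_preimage_def)
  show "F_preimage (F_map ` C) \<subseteq> C"
  proof
    fix p assume "p \<in> F_preimage (F_map ` C)"
    then obtain c where p: "p \<in> es_partitions_even" and c: "c \<in> C" "F_map p = F_map c"
      by (auto simp: F_preimage_def)
    obtain c' where c': "c' \<in> C" "F_map c' = F_map p" "even (length (lower c')) = even (length (lower p))"
      using adjust_parity[OF c(1)] c(2) by metis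
    have words: "F_word (upper c') = F_word (upper p)" "F_word (lower c') = F_word (lower p)"
      using c'(2) by (metis F_map_sel)+
    have "even (length (upper p) + length (lower p))"
      using es_evenD(2)[OF p] by (simp add: total_length_def)
    \<comment> \<open>Both partitions have even length, so agreement in parity passes from the lower
      rows to the upper ones.\<close>
    then have "even (length (upper p) + length (upper c'))"
      using c'(3) C_parity[OF c'(1)] by simp
    then have "joined (upper p) (upper c')"
      using words by (simp add: joined_iff)
    then obtain r where r: "r \<in> C" "upper r = upper p" "lower r = upper c'"
      "F_map r = word_id (F_word (upper p))"
      by (auto simp: joined_def)
    have "joined (lower c') (lower p)"
      using words c'(3) by (simp add: joined_iff)
    then obtain s where s: "s \<in> C" "upper s = lower c'" "lower s = lower p"
      "F_map s = word_id (F_word (lower c'))"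
      by (auto simp: joined_def)
    have cr: "compose c' r \<in> C"
      using C_compose r c'(1) by simp
    have scr: "compose s (compose c' r) \<in> C"
      using C_compose[OF cr s(1)] s by simp
    note F = F_map_colored[OF es_evenD(1)[OF p]]
    have "F_map (compose c' r) = F_map p"
      using F_map_compose[OF C_es[OF r(1)] C_es[OF c'(1)]] r c'(2)
        compose_word_id_right[OF F, of "F_word (upper p)"] by simp
    then have "F_map (compose s (compose c' r)) = F_map p"
      using F_map_compose[OF C_es[OF cr] C_es[OF s(1)]] s words
        compose_word_id_left[OF F, of "F_word (lower p)"] by simp
    then have "compose s (compose c' r) = p"
      using F_map_inject[OF C_es[OF scr] es_evenD(1)[OF p]] r s by simp
    with scr show "p \<in> C" by simp
  qed
qed

end

section \<open>From two colors to extra singletons\<close>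

context
  fixes D
  assumes cat: "tc_category D" and inv: "color_inversion_invariant D"
begin

lemma D_tensor: "p \<in> D \<Longrightarrow> q \<in> D \<Longrightarrow> tensor p q \<in> D"
  and D_compose: "p \<in> D \<Longrightarrow> q \<in> D \<Longrightarrow> lower p = upper q \<Longrightarrow> compose q p \<in> D"
  and D_involution: "p \<in> D \<Longrightarrow> involution p \<in> D"
  and D_colored: "p \<in> D \<Longrightarrow> p \<in> colored_partitions"
  using cat by (auto simp: tc_category_def closed_under_operations_def tc_partitions_def)

lemma D_inversion: "p \<in> D \<Longrightarrow> color_inversion p \<in> D"
  using inv by (auto simp: color_inversion_invariant_def)

text \<open>Closing the pair with its own involution leaves one component touching neither outer
  row, which is discarded. The result is the image of the triangle generators.\<close>

lemma D_empty: "word_id [] \<in> D"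
proof -
  let ?p = "CPartition [] [White, Black] {{Lo 0, Lo 1}}"
  have p: "?p \<in> D"
    using cat by (simp add: tc_category_def)
  have "compose (involution ?p) ?p = word_id []"
    by (rule cpartition.expand) (simp add: points_def)
  then show ?thesis
    using D_compose[OF p D_involution[OF p]] by simp
qed

text \<open>Invariance of \<open>D\<close> under color inversion enters in the tensor product, where
  a first factor with odd rows inverts the second.\<close>

lemma closed_F_preimage: "closed_under_operations (F_preimage D)"
proof -
  have "tensor p q \<in> F_preimage D" if "p \<in> F_preimage D" "q \<in> F_preimage D" for p q
    using that F_map_tensor_even[of p q] closed_even D_tensor D_inversion
    by (auto simp: F_preimage_def closed_under_operations_def)
  moreover have "compose q p \<in> F_preimage D"
    if "p \<in> F_preimage D" "q \<in> F_preimage D" "lower p = upper q" for p q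
    using that F_map_compose[of p q] closed_even D_compose[of "F_map p" "F_map q"]
    by (auto simp: F_preimage_def closed_under_operations_def es_evenD)
  moreover have "involution p \<in> F_preimage D" if "p \<in> F_preimage D" for p
    using that F_map_involution[of p] closed_even D_involution
    by (auto simp: F_preimage_def closed_under_operations_def)
  ultimately show ?thesis by (simp add: closed_under_operations_def)
qed

lemma es_category_F_preimage: "es_category (F_preimage D)"
proof -
  have "F_preimage D \<subseteq> es_partitions"
    by (auto simp: F_preimage_def es_evenD)
  moreover have "CPartition [White] [White] {{Up 0, Lo 0}} \<in> D"
    "CPartition [] [White, Black] {{Lo 0, Lo 1}} \<in> D"
    using cat by (simp_all add: tc_category_def)
  ultimately show ?thesis
    using closed_F_preimage D_empty generators_even
    by (simp add: es_category_def F_preimage_def F_map_generators[simplified])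
qed

lemma F_image_F_preimage: "F_map ` F_preimage D = D"
proof
  show "D \<subseteq> F_map ` F_preimage D"
  proof
    fix t assume t: "t \<in> D"
    then obtain p where "p \<in> es_partitions_even" "F_map p = t"
      using F_map_surj_even[OF D_colored] by blast
    then show "t \<in> F_map ` F_preimage D"
      using t by (auto simp: F_preimage_def)
  qed
qed (auto simp: F_preimage_def)

end

lemma F_preimage_even: "F_preimage D \<subseteq> es_partitions_even"
  by (simp add: F_preimage_def)

theorem theoremA:
  "bij_betw (\<lambda>C. F_map ` C)
     {C. es_category C \<and> C \<subseteq> es_partitions_even}
     {D. tc_category D \<and> color_inversion_invariant D}
   \<and> (\<forall>C. es_category C \<and> C \<subseteq> es_partitions_even \<longrightarrow>
        tc_category (F_map ` C) \<and> color_inversion_invariant (F_map ` C))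
   \<and> (\<forall>D. tc_category D \<and> color_inversion_invariant D \<longrightarrow>
        es_category (F_preimage D) \<and> F_preimage D \<subseteq> es_partitions_even)
   \<and> (\<forall>C. es_category C \<and> C \<subseteq> es_partitions_even \<longrightarrow> F_preimage (F_map ` C) = C)
   \<and> (\<forall>D. tc_category D \<and> color_inversion_invariant D \<longrightarrow> F_map ` F_preimage D = D)"
proof (intro conjI)
  show "bij_betw (\<lambda>C. F_map ` C)
     {C. es_category C \<and> C \<subseteq> es_partitions_even}
     {D. tc_category D \<and> color_inversion_invariant D}"
    by (rule bij_betw_byWitness[where f' = F_preimage])
      (use F_preimage_F_image F_image_F_preimage tc_category_F_image invariant_F_image
        es_category_F_preimage F_preimage_even[THEN subsetD] in auto)
qed (use F_preimage_F_image F_image_F_preimage tc_category_F_image invariant_F_image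
    es_category_F_preimage F_preimage_even[THEN subsetD] in auto)

end
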